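(* Let $V$ be a real separable Hilbert space and let $a,b,m$ be symmetric bilinear forms on $V$ such that $a$ is continuous and $V$-coercive, $b$ is weakly continuous, and $m$ is weakly continuous with $m(u,u)>0$ for all nonzero $u\in V$. Let $\mu\in\mathbb{R}$ be fixed. If $e_1,e_2$ are eigenvectors of $(a,b,m)$ corresponding to distinct eigenpoints $(\lambda_1,\mu)$ and $(\lambda_2,\mu)$ in $\sigma(a,b,m)$, respectively, then $$b(e_1,e_2)=0\qquad\text{and}\qquad a(e_1,e_2)-\mu\,m(e_1,e_2)=0.$$
   Context: "$a$ is continuous and $V$-coercive" means there are constants $0<\kappa_1\le\kappa_2<\infty$ with $\kappa_1\|u\|^2\le a(u,u)\le\kappa_2\|u\|^2$ for all $u\in V$. A symmetric bilinear form $b$ on $V$ is weakly continuous if $u_j\rightharpoonup u$ and $v_j\rightharpoonup v$ weakly in $V$ imply $b(u_j,v_j)\to b(u,v)$. A pair $(\lambda,\mu)\in\mathbb{R}^2$ is an eigenpoint of $(a,b,m)$ if there is a nonzero $u\in V$ (an eigenvector corresponding to $(\lambda,\mu)$) with $a(u,v)=\lambda\,b(u,v)+\mu\,m(u,v)$ for all $v\in V$; $\sigma(a,b,m)\subset\mathbb{R}^2$ is the set of all eigenpoints. *)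

theory Defs
  imports "HOL-Analysis.Analysis"
begin

definition symmetric_bilinear_form :: "('v::real_vector \<Rightarrow> 'v \<Rightarrow> real) \<Rightarrow> bool" where
  "symmetric_bilinear_form b \<longleftrightarrow> bilinear b \<and> (\<forall>u v. b u v = b v u)"

definition continuous_coercive_form :: "('v::real_normed_vector \<Rightarrow> 'v \<Rightarrow> real) \<Rightarrow> bool" where
  "continuous_coercive_form a \<longleftrightarrow>
     (\<exists>\<kappa>\<^sub>1 \<kappa>\<^sub>2. 0 < \<kappa>\<^sub>1 \<and> \<kappa>\<^sub>1 \<le> \<kappa>\<^sub>2 \<and>
        (\<forall>u. \<kappa>\<^sub>1 * (norm u)\<^sup>2 \<le> a u u \<and> a u u \<le> \<kappa>\<^sub>2 * (norm u)\<^sup>2))"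

definition weakly_converges :: "(nat \<Rightarrow> 'v::real_normed_vector) \<Rightarrow> 'v \<Rightarrow> bool" where
  "weakly_converges x l \<longleftrightarrow>
     (\<forall>f :: 'v \<Rightarrow> real. bounded_linear f \<longrightarrow> (\<lambda>j. f (x j)) \<longlonglongrightarrow> f l)"

definition weakly_continuous_form :: "('v::real_normed_vector \<Rightarrow> 'v \<Rightarrow> real) \<Rightarrow> bool" where
  "weakly_continuous_form b \<longleftrightarrow>
     (\<forall>x y u v. weakly_converges x u \<longrightarrow> weakly_converges y v \<longrightarrow>
        (\<lambda>j. b (x j) (y j)) \<longlonglongrightarrow> b u v)"

definition eigenvector ::
  "('v::real_vector \<Rightarrow> 'v \<Rightarrow> real) \<Rightarrow> ('v \<Rightarrow> 'v \<Rightarrow> real) \<Rightarrow> ('v \<Rightarrow> 'v \<Rightarrow> real) \<Rightarrow> real \<times> real \<Rightarrow> 'v \<Rightarrow> bool"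
  where
  "eigenvector a b m p u \<longleftrightarrow>
     u \<noteq> 0 \<and> (\<forall>v. a u v = fst p * b u v + snd p * m u v)"

definition eigenpoints ::
  "('v::real_vector \<Rightarrow> 'v \<Rightarrow> real) \<Rightarrow> ('v \<Rightarrow> 'v \<Rightarrow> real) \<Rightarrow> ('v \<Rightarrow> 'v \<Rightarrow> real) \<Rightarrow> (real \<times> real) set"
  where
  "eigenpoints a b m = {p. \<exists>u. eigenvector a b m p u}"

end

theory Submission
  imports Defs
begin

text \<open>
  Testing each eigenvector's equation against the other eigenvector, and using the symmetry of
  \<open>a\<close>, \<open>b\<close> and \<open>m\<close>, evaluates the single number \<open>a e\<^sub>1 e\<^sub>2 - \<mu> * m e\<^sub>1 e\<^sub>2\<close> both as
  \<open>l\<^sub>1 * b e\<^sub>1 e\<^sub>2\<close> and as \<open>l\<^sub>2 * b e\<^sub>1 e\<^sub>2\<close>. Since the two eigenpoints share \<open>\<mu>\<close>, they can differ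
  only in the first coordinate, so \<open>b e\<^sub>1 e\<^sub>2 = 0\<close> and with it the number itself vanishes.
  This is the usual orthogonality of eigenvectors for the pencil of \<open>a - \<mu> m\<close> and \<open>b\<close>.
\<close>

theorem corollary5p2:
  fixes a b m :: "'v::{real_inner, complete_space} \<Rightarrow> 'v \<Rightarrow> real"
    and \<mu> l\<^sub>1 l\<^sub>2 :: real
    and e\<^sub>1 e\<^sub>2 :: 'v
  assumes "separable_space (euclidean :: 'v topology)"
    and "symmetric_bilinear_form a"
    and "symmetric_bilinear_form b"
    and "symmetric_bilinear_form m"
    and "continuous_coercive_form a"
    and "weakly_continuous_form b"
    and "weakly_continuous_form m"
    and "\<And>u. u \<noteq> 0 \<Longrightarrow> m u u > 0"
    and "(l\<^sub>1, \<mu>) \<in> eigenpoints a b m"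
    and "(l\<^sub>2, \<mu>) \<in> eigenpoints a b m"
    and "(l\<^sub>1, \<mu>) \<noteq> (l\<^sub>2, \<mu>)"
    and "eigenvector a b m (l\<^sub>1, \<mu>) e\<^sub>1"
    and "eigenvector a b m (l\<^sub>2, \<mu>) e\<^sub>2"
  shows "b e\<^sub>1 e\<^sub>2 = 0 \<and> a e\<^sub>1 e\<^sub>2 - \<mu> * m e\<^sub>1 e\<^sub>2 = 0"
proof -
  have sym: "a e\<^sub>2 e\<^sub>1 = a e\<^sub>1 e\<^sub>2" "b e\<^sub>2 e\<^sub>1 = b e\<^sub>1 e\<^sub>2" "m e\<^sub>2 e\<^sub>1 = m e\<^sub>1 e\<^sub>2"
    using assms(2-4) unfolding symmetric_bilinear_form_def by blast+
  have eq1: "a e\<^sub>1 e\<^sub>2 - \<mu> * m e\<^sub>1 e\<^sub>2 = l\<^sub>1 * b e\<^sub>1 e\<^sub>2"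
    using assms(12) by (simp add: eigenvector_def)
  have "a e\<^sub>2 e\<^sub>1 - \<mu> * m e\<^sub>2 e\<^sub>1 = l\<^sub>2 * b e\<^sub>2 e\<^sub>1"
    using assms(13) by (simp add: eigenvector_def)
  then have eq2: "a e\<^sub>1 e\<^sub>2 - \<mu> * m e\<^sub>1 e\<^sub>2 = l\<^sub>2 * b e\<^sub>1 e\<^sub>2"
    by (simp only: sym)
  have "l\<^sub>1 \<noteq> l\<^sub>2"
    using assms(11) by simp
  with eq1 eq2 have "b e\<^sub>1 e\<^sub>2 = 0"
    by simp
  with eq1 show ?thesis
    by simp
qed

end
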